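(* Let $\Bbbk$ be a field and let $d \ge 2$ be a fixed integer. For each $n$, let $\mathcal{I}(n,d)$ be the set of squarefree monomial ideals of $\Bbbk[x_1,\dots,x_n]$ whose minimal generators are exactly $\frac12\binom{n}{d}$ monomials, all of degree $d$, and let $\mathrm{FI}(n,d)$ be the set of $f$-ideals of $\Bbbk[x_1,\dots,x_n]$ all of whose minimal generators have degree $d$. Then $$\lim_{n \to \infty} \frac{\#\mathrm{FI}(n,d)}{\#\mathcal{I}(n,d)} = 0,$$ where the limit is taken over those $n \ge d$ for which $\binom{n}{d}$ is even (so that $\mathcal{I}(n,d)\neq\emptyset$).
   Context: Let $I \subseteq \Bbbk[x_1,\dots,x_n]$ be a squarefree monomial ideal whose minimal monomial generators all have degree at least 2. Identify a subset $F \subseteq \{x_1,\dots,x_n\}$ with the squarefree monomial $x_F = \prod_{x_i \in F} x_i$. The Stanley-Reisner complex $\Delta_I$ is the simplicial complex whose faces are the sets $F$ with $x_F \notin I$. The facet complex $\Delta(I)$ is the simplicial complex whose facets are the sets $F$ such that $x_F$ is a minimal generator of $I$; that is, its faces are the sets $F$ such that $x_F$ divides some minimal generator of $I$. The $f$-vector of a simplicial complex of dimension $e$ is $(f_{-1},f_0,\dots,f_e)$, where $f_i$ is the number of faces with $i+1$ elements ($f_{-1}=1$ for a nonempty complex). The ideal $I$ is called an $f$-ideal if $\Delta_I$ and $\Delta(I)$ have the same $f$-vector. *)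

theory Defs
  imports
    Complex_Main
    "HOL-Library.Poly_Mapping"
    "HOL-Algebra.Ideal"
    "HOL-Algebra.Divisibility"
begin

section \<open>The polynomial rings\<close>

text \<open>An exponent vector is an element of \<^typ>\<open>nat \<Rightarrow>\<^sub>0 nat\<close>, a polynomial over \<open>'k\<close> in the variables
  \<open>x\<^sub>i\<close>, \<open>i :: nat\<close>, is a finitely supported map from exponent vectors to coefficients, and
  multiplication is convolution. The number \<open>n\<close> of variables has to vary inside a statement, so
  \<open>k[x\<^sub>1, \<dots>, x\<^sub>n]\<close> is the ring whose carrier consists of the polynomials that involve only
  variables with index in \<open>{1..n}\<close>. Sets of variables are represented by their index sets.\<close>

type_synonym 'k mpoly = "(nat \<Rightarrow>\<^sub>0 nat) \<Rightarrow>\<^sub>0 'k"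

definition poly_ring :: "nat \<Rightarrow> 'k::field mpoly ring" where
  "poly_ring n =
     \<lparr>carrier = {p. \<forall>m\<in>Poly_Mapping.keys p. Poly_Mapping.keys m \<subseteq> {1..n}},
      monoid.mult = (*), one = 1, zero = 0, add = (+)\<rparr>"

definition pvar :: "nat \<Rightarrow> 'k::field mpoly" where
  "pvar i = Poly_Mapping.single (Poly_Mapping.single i 1) 1"

definition sqfree_monom :: "nat set \<Rightarrow> 'k::field mpoly" where
  "sqfree_monom F = (\<Prod>i\<in>F. pvar i)"

definition monomials :: "nat \<Rightarrow> 'k::field mpoly set" where
  "monomials n = {Poly_Mapping.single m 1 |m. Poly_Mapping.keys m \<subseteq> {1..n}}"

definition total_degree :: "'k::field mpoly \<Rightarrow> nat" where
  "total_degree p =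
     Max (insert 0 ((\<lambda>m. \<Sum>i\<in>Poly_Mapping.keys m. Poly_Mapping.lookup m i) ` Poly_Mapping.keys p))"


section \<open>Squarefree monomial ideals and their minimal generators\<close>

definition squarefree_monomial_ideal :: "nat \<Rightarrow> 'k::field mpoly set \<Rightarrow> bool" where
  "squarefree_monomial_ideal n I \<longleftrightarrow>
     (\<exists>S. S \<subseteq> sqfree_monom ` Pow {1..n} \<and> I = Idl\<^bsub>poly_ring n\<^esub> S)"

definition minimal_monomial_generating_set :: "nat \<Rightarrow> 'k::field mpoly set \<Rightarrow> 'k mpoly set \<Rightarrow> bool" where
  "minimal_monomial_generating_set n I G \<longleftrightarrow>
     G \<subseteq> monomials n \<and> Idl\<^bsub>poly_ring n\<^esub> G = I \<and> (\<forall>H. H \<subset> G \<longrightarrow> Idl\<^bsub>poly_ring n\<^esub> H \<noteq> I)"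

text \<open>Only used for squarefree monomial ideals, for which \<open>min_gens_unique\<close> below shows that
  the description is a proper one.\<close>

definition min_gens :: "nat \<Rightarrow> 'k::field mpoly set \<Rightarrow> 'k mpoly set" where
  "min_gens n I = (THE G. minimal_monomial_generating_set n I G)"


section \<open>The two complexes, \<open>f\<close>-vectors and \<open>f\<close>-ideals\<close>

text \<open>A simplicial complex is given by its set of faces.\<close>

definition stanley_reisner_complex :: "nat \<Rightarrow> 'k::field mpoly set \<Rightarrow> nat set set" where
  "stanley_reisner_complex n I = {F. F \<subseteq> {1..n} \<and> sqfree_monom F \<notin> I}"

definition facet_complex :: "nat \<Rightarrow> 'k::field mpoly set \<Rightarrow> nat set set" where
  "facet_complex n I =
     {F. F \<subseteq> {1..n} \<and> (\<exists>u\<in>min_gens n I. sqfree_monom F divides\<^bsub>poly_ring n\<^esub> u)}"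

text \<open>The list \<open>[f\<^sub>-\<^sub>1, f\<^sub>0, \<dots>, f\<^sub>e]\<close>, where \<open>e + 1\<close> is the maximal number of elements of a
  face. The complex without faces has dimension \<open>-\<infinity>\<close> and the empty \<open>f\<close>-vector.\<close>

definition f_vector :: "nat set set \<Rightarrow> nat list" where
  "f_vector \<Delta> =
     (if \<Delta> = {} then [] else map (\<lambda>j. card {F \<in> \<Delta>. card F = j}) [0..<Suc (Max (card ` \<Delta>))])"

definition f_ideal :: "nat \<Rightarrow> 'k::field mpoly set \<Rightarrow> bool" where
  "f_ideal n I \<longleftrightarrow>
     squarefree_monomial_ideal n I \<and>
     (\<forall>u\<in>min_gens n I. total_degree u \<ge> 2) \<and>
     f_vector (stanley_reisner_complex n I) = f_vector (facet_complex n I)"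

definition half_ideals :: "nat \<Rightarrow> nat \<Rightarrow> 'k::field mpoly set set" where
  "half_ideals n d =
     {I. squarefree_monomial_ideal n I \<and>
         2 * card (min_gens n I) = n choose d \<and>
         (\<forall>u\<in>min_gens n I. total_degree u = d)}"

definition f_ideals :: "nat \<Rightarrow> nat \<Rightarrow> 'k::field mpoly set set" where
  "f_ideals n d = {I. f_ideal n I \<and> (\<forall>u\<in>min_gens n I. total_degree u = d)}"

text \<open>The filter \<open>n \<rightarrow> \<infinity>\<close> along those \<open>n \<ge> d\<close> for which \<open>n choose d\<close> is even; it is proper by
  \<open>even_binomial_filter_neq_bot\<close> below.\<close>

definition even_binomial_filter :: "nat \<Rightarrow> nat filter" where
  "even_binomial_filter d = inf sequentially (principal {n. d \<le> n \<and> even (n choose d)})"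


section \<open>The definitions are meaningful\<close>

lemma keys_mult_subset:
  assumes "m \<in> Poly_Mapping.keys (p * q)"
  obtains a b where "a \<in> Poly_Mapping.keys p" "b \<in> Poly_Mapping.keys q" "m = a + b"
  using assms keys_mult[of p q] by blast

lemma keys_add_exponents:
  fixes a b :: "nat \<Rightarrow>\<^sub>0 nat"
  shows "Poly_Mapping.keys (a + b) = Poly_Mapping.keys a \<union> Poly_Mapping.keys b"
  by (auto simp: in_keys_iff lookup_add)

lemma carrier_poly_ring_iff:
  "p \<in> carrier (poly_ring n) \<longleftrightarrow> (\<forall>m\<in>Poly_Mapping.keys p. Poly_Mapping.keys m \<subseteq> {1..n})"
  by (simp add: poly_ring_def)

lemma poly_ring_simps [simp]:
  "monoid.mult (poly_ring n) = (*)" "one (poly_ring n) = 1"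
  "zero (poly_ring n) = 0" "add (poly_ring n) = (+)"
  by (simp_all add: poly_ring_def)

lemma poly_ring_closed:
  "0 \<in> carrier (poly_ring n)" "1 \<in> carrier (poly_ring n)"
  "p \<in> carrier (poly_ring n) \<Longrightarrow> q \<in> carrier (poly_ring n) \<Longrightarrow> p + q \<in> carrier (poly_ring n)"
  "p \<in> carrier (poly_ring n) \<Longrightarrow> - p \<in> carrier (poly_ring n)"
  "p \<in> carrier (poly_ring n) \<Longrightarrow> q \<in> carrier (poly_ring n) \<Longrightarrow> p * q \<in> carrier (poly_ring n)"
proof -
  show "p + q \<in> carrier (poly_ring n)"
    if "p \<in> carrier (poly_ring n)" "q \<in> carrier (poly_ring n)"
    using that keys_add[of p q] unfolding carrier_poly_ring_iff by blast
  show "p * q \<in> carrier (poly_ring n)"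
    if pq: "p \<in> carrier (poly_ring n)" "q \<in> carrier (poly_ring n)"
    unfolding carrier_poly_ring_iff
  proof
    fix m assume "m \<in> Poly_Mapping.keys (p * q)"
    then obtain a b where "a \<in> Poly_Mapping.keys p" "b \<in> Poly_Mapping.keys q" "m = a + b"
      by (rule keys_mult_subset)
    with pq show "Poly_Mapping.keys m \<subseteq> {1..n}"
      unfolding carrier_poly_ring_iff by (simp add: keys_add_exponents)
  qed
qed (auto simp: carrier_poly_ring_iff in_keys_iff)

lemma cring_poly_ring: "cring (poly_ring n :: 'k::field mpoly ring)"
proof (rule cringI)
  show "abelian_group (poly_ring n :: 'k mpoly ring)"
  proof (rule abelian_groupI)
    fix p :: "'k mpoly" assume "p \<in> carrier (poly_ring n)"
    then show "\<exists>y\<in>carrier (poly_ring n). y \<oplus>\<^bsub>poly_ring n\<^esub> p = \<zero>\<^bsub>poly_ring n\<^esub>"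
      by (intro bexI[of _ "- p"]) (auto simp: poly_ring_closed)
  qed (auto simp: poly_ring_closed algebra_simps)
  show "comm_monoid (poly_ring n :: 'k mpoly ring)"
    by (rule comm_monoidI) (auto simp: poly_ring_closed algebra_simps)
qed (auto simp: algebra_simps)

lemma monomials_carrier: "monomials n \<subseteq> carrier (poly_ring n)"
  by (auto simp: monomials_def carrier_poly_ring_iff split: if_splits)

lemma sqfree_monom_eq:
  assumes "finite F"
  shows "sqfree_monom F = Poly_Mapping.single (\<Sum>i\<in>F. Poly_Mapping.single i 1) 1"
  using assms by (induction F) (auto simp: sqfree_monom_def pvar_def mult_single)

lemma sqfree_monom_in_monomials:
  assumes "F \<subseteq> {1..n}"
  shows "sqfree_monom F \<in> monomials n"
proof -
  have "finite F" using assms finite_subset by blast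
  moreover have "Poly_Mapping.keys (\<Sum>i\<in>F. Poly_Mapping.single i (1::nat)) \<subseteq> {1..n}"
    using keys_sum[of "\<lambda>i. Poly_Mapping.single i (1::nat)" F] assms by (force split: if_splits)
  ultimately show ?thesis by (auto simp: sqfree_monom_eq monomials_def)
qed

lemma monomials_divides_antisym:
  fixes u v :: "'k::field mpoly"
  assumes "u \<in> monomials n" "v \<in> monomials n"
    and "u divides\<^bsub>poly_ring n\<^esub> v" "v divides\<^bsub>poly_ring n\<^esub> u"
  shows "u = v"
proof -
  have *: "\<exists>c. b = a + c"
    if "(Poly_Mapping.single a 1 :: 'k mpoly) divides\<^bsub>poly_ring n\<^esub> Poly_Mapping.single b 1"
      (is "?u divides\<^bsub>_\<^esub> ?v") for a b
  proof -
    have "\<exists>q. ?v = ?u * q" using that by (auto simp: factor_def)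
    then obtain q where q: "?v = ?u * q" ..
    have "b \<in> Poly_Mapping.keys (Poly_Mapping.single b 1 :: 'k mpoly)" by simp
    then have "b \<in> Poly_Mapping.keys (Poly_Mapping.single a 1 * q)" by (simp only: q)
    then obtain a' c where "a' \<in> Poly_Mapping.keys (Poly_Mapping.single a 1 :: 'k mpoly)" "b = a' + c"
      by (rule keys_mult_subset)
    then show ?thesis by auto
  qed
  obtain a b where ab: "u = Poly_Mapping.single a 1" "v = Poly_Mapping.single b 1"
    using assms(1,2) by (auto simp: monomials_def)
  obtain c c' where c: "b = a + c" "a = b + c'"
    using *[of a b] *[of b a] assms(3,4) ab by auto
  have "a = b"
  proof (rule poly_mapping_eqI)
    fix i
    have "Poly_Mapping.lookup b i = Poly_Mapping.lookup a i + Poly_Mapping.lookup c i"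
      by (metis c(1) lookup_add)
    moreover have "Poly_Mapping.lookup a i = Poly_Mapping.lookup b i + Poly_Mapping.lookup c' i"
      by (metis c(2) lookup_add)
    ultimately show "Poly_Mapping.lookup a i = Poly_Mapping.lookup b i" by linarith
  qed
  with ab show ?thesis by simp
qed

lemma monomial_in_genideal_iff:
  fixes v :: "'k::field mpoly"
  assumes S: "S \<subseteq> monomials n" and v: "v \<in> monomials n"
  shows "v \<in> Idl\<^bsub>poly_ring n\<^esub> S \<longleftrightarrow> (\<exists>u\<in>S. u divides\<^bsub>poly_ring n\<^esub> v)"
proof
  interpret cring "poly_ring n :: 'k mpoly ring" by (rule cring_poly_ring)
  have Sc: "S \<subseteq> carrier (poly_ring n)" using S monomials_carrier by blast
  {
    assume "\<exists>u\<in>S. u divides\<^bsub>poly_ring n\<^esub> v"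
    then obtain u c where u: "u \<in> S" "c \<in> carrier (poly_ring n)" "v = u * c"
      by (auto simp: factor_def)
    have "u \<in> Idl\<^bsub>poly_ring n\<^esub> S" using genideal_self[OF Sc] u by blast
    then show "v \<in> Idl\<^bsub>poly_ring n\<^esub> S"
      using ideal.I_r_closed[OF genideal_ideal[OF Sc] _ u(2), of u] u(3) by simp
  }
  define J :: "'k mpoly set" where "J = {p \<in> carrier (poly_ring n). \<forall>m\<in>Poly_Mapping.keys p.
      \<exists>u\<in>S. u divides\<^bsub>poly_ring n\<^esub> (Poly_Mapping.single m 1 :: 'k mpoly)}"
  have Jmult: "q * p \<in> J" if p: "p \<in> J" and q: "q \<in> carrier (poly_ring n)" for p q
  proof -
    have "\<exists>u\<in>S. u divides\<^bsub>poly_ring n\<^esub> (Poly_Mapping.single m 1 :: 'k mpoly)"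
      if m: "m \<in> Poly_Mapping.keys (q * p)" for m
    proof -
      obtain a b where ab: "a \<in> Poly_Mapping.keys q" "b \<in> Poly_Mapping.keys p" "m = a + b"
        using m by (rule keys_mult_subset)
      obtain u c where u: "u \<in> S" "c \<in> carrier (poly_ring n)"
          "Poly_Mapping.single b 1 = u * c"
        using p ab(2) by (auto simp: J_def factor_def)
      have a: "(Poly_Mapping.single a 1 :: 'k mpoly) \<in> carrier (poly_ring n)"
        using ab(1) q by (auto simp: carrier_poly_ring_iff split: if_splits)
      have "(Poly_Mapping.single m 1 :: 'k mpoly) = Poly_Mapping.single a 1 * (u * c)"
        unfolding u(3)[symmetric] ab(3) by (simp add: mult_single)
      also have "\<dots> = u * (c * Poly_Mapping.single a 1)" by (simp only: ac_simps)
      finally show ?thesis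
        using u a poly_ring_closed(5)[OF u(2) a] by (auto simp: factor_def)
    qed
    moreover have "q * p \<in> carrier (poly_ring n)" using p q by (simp add: J_def poly_ring_closed)
    ultimately show ?thesis by (simp add: J_def)
  qed
  have "ideal J (poly_ring n)"
  proof (rule idealI)
    show "ring (poly_ring n :: 'k mpoly ring)" by (rule ring_axioms)
    show "subgroup J (add_monoid (poly_ring n))"
    proof (rule add.subgroupI)
      show "J \<subseteq> carrier (poly_ring n)" by (auto simp: J_def)
      have "0 \<in> J" by (simp add: J_def poly_ring_closed)
      then show "J \<noteq> {}" by blast
    next
      fix p assume p: "p \<in> J"
      have m1: "- 1 \<in> carrier (poly_ring n :: 'k mpoly ring)" by (simp add: poly_ring_closed)
      have pc: "p \<in> carrier (poly_ring n)" "- p \<in> carrier (poly_ring n)"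
        using p by (auto simp: J_def poly_ring_closed)
      have "\<ominus>\<^bsub>poly_ring n\<^esub> p = - p" by (rule minus_equality) (use pc in simp_all)
      then show "\<ominus>\<^bsub>poly_ring n\<^esub> p \<in> J" using Jmult[OF p m1] by simp
    next
      fix p q assume "p \<in> J" "q \<in> J"
      then have "p + q \<in> J" using keys_add[of p q] unfolding J_def
        by (auto simp: poly_ring_closed)
      then show "p \<oplus>\<^bsub>poly_ring n\<^esub> q \<in> J" by simp
    qed
  qed (use Jmult in \<open>simp_all add: mult.commute\<close>)
  moreover have "S \<subseteq> J"
  proof
    fix u assume u: "u \<in> S"
    then obtain m where m: "u = Poly_Mapping.single m 1" using S by (auto simp: monomials_def)
    have "u divides\<^bsub>poly_ring n\<^esub> u" unfolding factor_def
      by (intro bexI[of _ 1]) (auto simp: poly_ring_closed)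
    then show "u \<in> J" using u Sc m by (auto simp: J_def)
  qed
  ultimately have "Idl\<^bsub>poly_ring n\<^esub> S \<subseteq> J" by (rule genideal_minimal)
  moreover obtain m where m: "v = Poly_Mapping.single m 1" using v by (auto simp: monomials_def)
  moreover assume "v \<in> Idl\<^bsub>poly_ring n\<^esub> S"
  ultimately show "\<exists>u\<in>S. u divides\<^bsub>poly_ring n\<^esub> v" by (auto simp: J_def)
qed

lemma min_gens_subset:
  fixes G H :: "'k::field mpoly set"
  assumes G: "minimal_monomial_generating_set n I G" and H: "minimal_monomial_generating_set n I H"
  shows "G \<subseteq> H"
proof
  interpret cring "poly_ring n :: 'k mpoly ring" by (rule cring_poly_ring)
  have mon: "G \<subseteq> monomials n" "H \<subseteq> monomials n"
    and gen: "Idl\<^bsub>poly_ring n\<^esub> G = I" "Idl\<^bsub>poly_ring n\<^esub> H = I"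
    using G H by (auto simp: minimal_monomial_generating_set_def)
  have carr: "G \<subseteq> carrier (poly_ring n)" "H \<subseteq> carrier (poly_ring n)"
    using mon monomials_carrier by blast+
  fix u assume u: "u \<in> G"
  have "u \<in> I" using genideal_self[OF carr(1)] u gen by blast
  then obtain h where h: "h \<in> H" "h divides\<^bsub>poly_ring n\<^esub> u"
    using monomial_in_genideal_iff[OF mon(2), of u] gen(2) mon(1) u by auto
  have "h \<in> I" using genideal_self[OF carr(2)] h gen by blast
  then obtain g where g: "g \<in> G" "g divides\<^bsub>poly_ring n\<^esub> h"
    using monomial_in_genideal_iff[OF mon(1), of h] gen(1) mon(2) h by auto
  have gu: "g divides\<^bsub>poly_ring n\<^esub> u"
    using divides_trans[OF g(2) h(2)] g(1) carr by blast
  have "g = u"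
  proof (rule ccontr)
    assume "g \<noteq> u"
    let ?G = "G - {u}"
    have mon': "?G \<subseteq> monomials n" and carr': "?G \<subseteq> carrier (poly_ring n)" using mon carr by auto
    have "u \<in> Idl\<^bsub>poly_ring n\<^esub> ?G"
      using monomial_in_genideal_iff[OF mon', of u] g(1) gu \<open>g \<noteq> u\<close> u mon(1) by blast
    then have "G \<subseteq> Idl\<^bsub>poly_ring n\<^esub> ?G" using genideal_self[OF carr'] by blast
    then have "Idl\<^bsub>poly_ring n\<^esub> G \<subseteq> Idl\<^bsub>poly_ring n\<^esub> ?G"
      by (rule genideal_minimal[OF genideal_ideal[OF carr']])
    moreover have "Idl\<^bsub>poly_ring n\<^esub> ?G \<subseteq> Idl\<^bsub>poly_ring n\<^esub> G"
      using genideal_minimal[OF genideal_ideal[OF carr(1)], of ?G] genideal_self[OF carr(1)] by blast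
    moreover have "?G \<subset> G" using u by blast
    ultimately show False using G gen(1) by (auto simp: minimal_monomial_generating_set_def)
  qed
  then have "h = u" using monomials_divides_antisym[of h n u] g h u mon by blast
  then show "u \<in> H" using h by simp
qed

theorem min_gens_unique:
  assumes "squarefree_monomial_ideal n I"
  shows "\<exists>!G. minimal_monomial_generating_set n I G"
proof (rule ex_ex1I)
  obtain S where S: "S \<subseteq> sqfree_monom ` Pow {1..n}" "I = Idl\<^bsub>poly_ring n\<^esub> S"
    using assms by (auto simp: squarefree_monomial_ideal_def)
  have fin: "finite (Pow S)" using S(1) finite_subset by fastforce
  let ?C = "{G. G \<subseteq> S \<and> Idl\<^bsub>poly_ring n\<^esub> G = I}"
  have "finite ?C" using fin by (rule finite_subset[rotated]) blast
  moreover have "?C \<noteq> {}" using S(2) by blast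
  ultimately obtain G where "G \<in> ?C" "\<forall>H\<in>?C. H \<subseteq> G \<longrightarrow> G = H"
    using finite_has_minimal[of ?C] by blast
  then have G: "G \<subseteq> S" "Idl\<^bsub>poly_ring n\<^esub> G = I"
      "\<And>H. H \<subseteq> S \<Longrightarrow> Idl\<^bsub>poly_ring n\<^esub> H = I \<Longrightarrow> H \<subseteq> G \<Longrightarrow> H = G"
    by blast+
  have "G \<subseteq> monomials n" using G(1) S(1) sqfree_monom_in_monomials by blast
  then have "minimal_monomial_generating_set n I G"
    using G unfolding minimal_monomial_generating_set_def by blast
  then show "\<exists>G. minimal_monomial_generating_set n I G" ..
qed (meson min_gens_subset subset_antisym)

lemma finite_squarefree_monomial_ideals:
  "finite {I :: 'k::field mpoly set. squarefree_monomial_ideal n I}"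
proof -
  have "{I :: 'k mpoly set. squarefree_monomial_ideal n I} =
      (\<lambda>S. Idl\<^bsub>poly_ring n\<^esub> S) ` Pow (sqfree_monom ` Pow {1..n})"
    by (auto simp: squarefree_monomial_ideal_def)
  moreover have "finite \<dots>" by (intro finite_imageI finite_Pow_iff[THEN iffD2]) simp
  ultimately show ?thesis by simp
qed

lemma finite_half_ideals: "finite (half_ideals n d)" and finite_f_ideals: "finite (f_ideals n d)"
  by (rule finite_subset[OF _ finite_squarefree_monomial_ideals[of n]];
      auto simp: half_ideals_def f_ideals_def f_ideal_def)+

lemma even_binomial_filter_neq_bot:
  assumes "d \<ge> 1"
  shows "even_binomial_filter d \<noteq> bot"
proof
  assume "even_binomial_filter d = bot"
  then have "eventually (\<lambda>n. \<not> (d \<le> n \<and> even (n choose d))) sequentially"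
    unfolding even_binomial_filter_def trivial_limit_def eventually_inf_principal by simp
  then obtain N where N: "\<And>n. n \<ge> N \<Longrightarrow> \<not> (d \<le> n \<and> even (n choose d))"
    by (auto simp: eventually_sequentially)
  define n where "n = d * (2 * Suc N)"
  have "n \<ge> N" "n \<ge> d" using assms by (simp_all add: n_def trans_le_add2)
  have "d * (n choose d) = n * ((n - 1) choose (d - 1))"
    using times_binomial_minus1_eq[of d n] assms by simp
  also have "\<dots> = d * (2 * Suc N * ((n - 1) choose (d - 1)))" by (simp only: n_def mult.assoc)
  finally have "n choose d = 2 * Suc N * ((n - 1) choose (d - 1))"
    using assms by (metis mult_cancel1 not_one_le_zero)
  then have "even (n choose d)" by simp
  with N \<open>n \<ge> N\<close> \<open>n \<ge> d\<close> show False by blast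
qed

end

theory Submission
  imports Defs
begin

text \<open>A squarefree monomial ideal generated in degree \<open>d\<close> is the same as a family of \<open>d\<close>-subsets of
  \<open>{1..n}\<close>, the supports of its minimal generators. Put \<open>N = n choose d\<close>. Every family of
  \<open>N / 2\<close> such subsets gives a different ideal counted in the denominator, so the denominator is at least
  the central binomial coefficient, which in turn is at least \<open>2 ^ N / N\<close>
  (\<open>card_half_ideals_ge\<close>, \<open>two_power_le_central_binomial\<close>).

  For an \<open>f\<close>-ideal the two complexes have the same dimension. The facet complex has no face with
  more than \<open>d\<close> elements, so neither has the Stanley-Reisner complex: every \<open>(d + 1)\<close>-set
  contains the support of a generator (\<open>f_ideal_contains_generator\<close>). This condition alone is
  already very restrictive. The set \<open>{1..n}\<close> contains \<open>n div (d + 1)\<close> disjoint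
  \<open>(d + 1)\<close>-sets; the \<open>d\<close>-subsets of these form disjoint blocks of \<open>d + 1\<close> elements, each of
  which must be met by the family of generators. A random family, in which each \<open>d\<close>-subset
  occurs independently with probability \<open>1 / 2\<close>, misses a given block with probability
  \<open>1 / 2 ^ (d + 1)\<close>, and by independence meets all of them with probability
  \<open>(1 - 1 / 2 ^ (d + 1)) ^ (n div (d + 1))\<close> (\<open>card_meeting_blocks_le\<close>).

  Comparing the numerator with all \<open>2 ^ N\<close> families, rather than with those of size \<open>N / 2\<close>,
  costs only the factor \<open>N \<le> n ^ d\<close>, so the independent model suffices and the correlations among
  families of fixed size do not have to be estimated. The ratio is at most
  \<open>n ^ d * (1 - 1 / 2 ^ (d + 1)) ^ (n div (d + 1))\<close>, a polynomial times an exponentially small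
  term (\<open>ratio_le\<close>).\<close>


section \<open>Squarefree monomials\<close>

lemma keys_sum_single:
  fixes F :: "nat set"
  assumes "finite F"
  shows "Poly_Mapping.keys (\<Sum>i\<in>F. Poly_Mapping.single i (1::nat)) = F"
  using assms by (induction F rule: finite_induct) (simp_all add: keys_add_exponents)

lemma sqfree_monom_keys:
  assumes "finite F"
  obtains e where "sqfree_monom F = (Poly_Mapping.single e 1 :: 'k::field mpoly)"
    "Poly_Mapping.keys e = F"
proof (rule that)
  show "sqfree_monom F = (Poly_Mapping.single (\<Sum>i\<in>F. Poly_Mapping.single i 1) 1 :: 'k mpoly)"
    by (rule sqfree_monom_eq[OF assms])
qed (rule keys_sum_single[OF assms])

text \<open>In a divisibility of monomials the cofactor can be read off from a single key: the exponent
  of the multiple is the exponent of the divisor plus a vector of natural numbers, and such a sum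
  cannot lose support.\<close>

lemma sqfree_monom_divides_imp_subset:
  assumes "finite F" "finite G"
    and dvd: "(sqfree_monom F :: 'k::field mpoly) divides\<^bsub>poly_ring n\<^esub> sqfree_monom G"
  shows "F \<subseteq> G"
proof -
  obtain e where e: "sqfree_monom F = (Poly_Mapping.single e 1 :: 'k mpoly)"
    "Poly_Mapping.keys e = F" by (rule sqfree_monom_keys[OF assms(1)])
  obtain e' where e': "sqfree_monom G = (Poly_Mapping.single e' 1 :: 'k mpoly)"
    "Poly_Mapping.keys e' = G" by (rule sqfree_monom_keys[OF assms(2)])
  obtain q where q: "(Poly_Mapping.single e' 1 :: 'k mpoly) = Poly_Mapping.single e 1 * q"
    using dvd e(1) e'(1) by (auto simp: factor_def)
  have "e' \<in> Poly_Mapping.keys (Poly_Mapping.single e' 1 :: 'k mpoly)" by simp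
  then have "e' \<in> Poly_Mapping.keys (Poly_Mapping.single e 1 * q)" by (simp only: q)
  then obtain a c where "a \<in> Poly_Mapping.keys (Poly_Mapping.single e 1 :: 'k mpoly)" "e' = a + c"
    by (rule keys_mult_subset)
  then have "e' = e + c" by simp
  with e(2) e'(2) show ?thesis by (auto simp: keys_add_exponents)
qed

lemma inj_on_sqfree_monom:
  "inj_on (sqfree_monom :: nat set \<Rightarrow> 'k::field mpoly) (Collect finite)"
proof (rule inj_onI)
  fix F G :: "nat set"
  assume fin: "F \<in> Collect finite" "G \<in> Collect finite"
    and eq: "(sqfree_monom F :: 'k mpoly) = sqfree_monom G"
  from fin have fin': "finite F" "finite G" by auto
  obtain e where "sqfree_monom F = (Poly_Mapping.single e 1 :: 'k mpoly)"
    "Poly_Mapping.keys e = F" by (rule sqfree_monom_keys[OF fin'(1)])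
  moreover obtain e' where "sqfree_monom G = (Poly_Mapping.single e' 1 :: 'k mpoly)"
    "Poly_Mapping.keys e' = G" by (rule sqfree_monom_keys[OF fin'(2)])
  ultimately show "F = G"
    using eq by (metis keys_single one_neq_zero singleton_inject)
qed

lemma total_degree_sqfree_monom:
  assumes "finite F"
  shows "total_degree (sqfree_monom F :: 'k::field mpoly) = card F"
proof -
  let ?e = "\<Sum>i\<in>F. Poly_Mapping.single i (1::nat)"
  have "Poly_Mapping.lookup ?e i = 1" if "i \<in> F" for i
    using assms that
    by (simp add: lookup_sum lookup_single when_def sum.delta)
  then have "(\<Sum>i\<in>Poly_Mapping.keys ?e. Poly_Mapping.lookup ?e i) = card F"
    unfolding keys_sum_single[OF assms] by (simp cong: sum.cong)
  then show ?thesis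
    by (simp add: total_degree_def sqfree_monom_eq[OF assms])
qed


section \<open>Minimal generators\<close>

lemma min_gens_eqI:
  assumes "squarefree_monomial_ideal n I" "minimal_monomial_generating_set n I G"
  shows "min_gens n I = G"
  unfolding min_gens_def using min_gens_unique[OF assms(1)] assms(2) by (rule the1_equality)

lemma min_gens_minimal:
  assumes "squarefree_monomial_ideal n I"
  shows "minimal_monomial_generating_set n I (min_gens n I)"
  unfolding min_gens_def using min_gens_unique[OF assms] by (rule theI')

text \<open>An inclusion-minimal generating subset of a finite set \<open>S\<close> of squarefree generators is a
  minimal monomial generating set, so by uniqueness it is the set of minimal generators.\<close>

lemma min_gens_subset_sqfree_monom:
  fixes I :: "'k::field mpoly set"
  assumes "squarefree_monomial_ideal n I"
  shows "min_gens n I \<subseteq> sqfree_monom ` Pow {1..n}"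
proof -
  obtain S where S: "S \<subseteq> sqfree_monom ` Pow {1..n}" "I = Idl\<^bsub>poly_ring n\<^esub> S"
    using assms by (auto simp: squarefree_monomial_ideal_def)
  let ?C = "{G. G \<subseteq> S \<and> Idl\<^bsub>poly_ring n\<^esub> G = I}"
  have "finite S" using S(1) finite_subset by fastforce
  then have "finite ?C" by (auto intro: finite_subset[of _ "Pow S"])
  moreover have "?C \<noteq> {}" using S(2) by blast
  ultimately obtain G where "G \<in> ?C" "\<forall>H\<in>?C. H \<subseteq> G \<longrightarrow> G = H"
    using finite_has_minimal[of ?C] by blast
  then have G: "G \<subseteq> S" "Idl\<^bsub>poly_ring n\<^esub> G = I"
      "\<And>H. H \<subseteq> S \<Longrightarrow> Idl\<^bsub>poly_ring n\<^esub> H = I \<Longrightarrow> H \<subseteq> G \<Longrightarrow> H = G"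
    by blast+
  have "G \<subseteq> monomials n" using G(1) S(1) sqfree_monom_in_monomials by blast
  then have "minimal_monomial_generating_set n I G"
    using G unfolding minimal_monomial_generating_set_def by blast
  from min_gens_eqI[OF assms this] G(1) S(1) show ?thesis by blast
qed

definition gen_family :: "nat \<Rightarrow> 'k::field mpoly set \<Rightarrow> nat set set" where
  "gen_family n I = {F. F \<subseteq> {1..n} \<and> sqfree_monom F \<in> min_gens n I}"

lemma image_gen_family:
  assumes "squarefree_monomial_ideal n I"
  shows "sqfree_monom ` gen_family n I = min_gens n I"
  using min_gens_subset_sqfree_monom[OF assms] by (auto simp: gen_family_def)

text \<open>The ideal is recovered from its family because its minimal generators generate it.\<close>

lemma inj_on_gen_family:
  "inj_on (gen_family n) {I :: 'k::field mpoly set. squarefree_monomial_ideal n I}"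
proof (rule inj_onI)
  fix I J :: "'k mpoly set"
  assume "I \<in> {I. squarefree_monomial_ideal n I}" "J \<in> {I. squarefree_monomial_ideal n I}"
    and eq: "gen_family n I = gen_family n J"
  then have IJ: "squarefree_monomial_ideal n I" "squarefree_monomial_ideal n J" by auto
  have "min_gens n I = min_gens n J"
    using image_gen_family[OF IJ(1)] image_gen_family[OF IJ(2)] eq by simp
  then show "I = J"
    using min_gens_minimal[OF IJ(1)] min_gens_minimal[OF IJ(2)]
    by (simp add: minimal_monomial_generating_set_def)
qed

text \<open>Distinct sets of the same size are incomparable, so among monomials of the same degree none
  divides another and no generator is redundant.\<close>

lemma min_gens_uniform_family:
  fixes A :: "nat set set"
  assumes A: "A \<subseteq> {F. F \<subseteq> {1..n} \<and> card F = d}"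
  defines "I \<equiv> Idl\<^bsub>poly_ring n\<^esub> (sqfree_monom ` A :: 'k::field mpoly set)"
  shows "squarefree_monomial_ideal n I" and "min_gens n I = sqfree_monom ` A"
proof -
  interpret cring "poly_ring n :: 'k mpoly ring" by (rule cring_poly_ring)
  let ?G = "sqfree_monom ` A :: 'k mpoly set"
  have fin: "finite F" if "F \<in> A" for F
    using A that finite_subset[of F "{1..n}"] by auto
  have sub: "?G \<subseteq> sqfree_monom ` Pow {1..n}" using A by auto
  then show sq: "squarefree_monomial_ideal n I"
    unfolding squarefree_monomial_ideal_def I_def by blast
  have mon: "?G \<subseteq> monomials n"
    by (rule image_subsetI, rule sqfree_monom_in_monomials) (use A in blast)
  have "Idl\<^bsub>poly_ring n\<^esub> H \<noteq> I" if H: "H \<subset> ?G" for H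
  proof
    assume eq: "Idl\<^bsub>poly_ring n\<^esub> H = I"
    obtain F where F: "F \<in> A" "sqfree_monom F \<notin> H" using H by blast
    have FG: "sqfree_monom F \<in> ?G" using F(1) by (rule imageI)
    moreover have "?G \<subseteq> I"
      unfolding I_def by (rule genideal_self[OF subset_trans[OF mon monomials_carrier]])
    ultimately have "(sqfree_monom F :: 'k mpoly) \<in> Idl\<^bsub>poly_ring n\<^esub> H" unfolding eq by (rule rev_subsetD)
    moreover have "H \<subseteq> monomials n" using H mon by (rule psubset_subset_trans[THEN psubset_imp_subset])
    moreover have "(sqfree_monom F :: 'k mpoly) \<in> monomials n" using FG mon by (rule rev_subsetD)
    ultimately obtain u where u: "u \<in> H" "u divides\<^bsub>poly_ring n\<^esub> (sqfree_monom F :: 'k mpoly)"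
      using monomial_in_genideal_iff[of H n "sqfree_monom F"] by auto
    then obtain F' where F': "F' \<in> A" "u = sqfree_monom F'" using H by blast
    have "F' \<subseteq> F"
      using sqfree_monom_divides_imp_subset[OF fin[OF F'(1)] fin[OF F(1)]] u(2) F'(2) by simp
    moreover have "card F' = card F" using A F(1) F'(1) by auto
    ultimately have "F' = F" using card_subset_eq fin F(1) by blast
    then show False using F(2) F'(2) u(1) by simp
  qed
  then have "minimal_monomial_generating_set n I ?G"
    using mon by (auto simp: minimal_monomial_generating_set_def I_def)
  then show "min_gens n I = ?G" by (rule min_gens_eqI[OF sq])
qed

lemma card_half_ideals_ge:
  assumes "even (n choose d)"
  shows "(n choose d) choose ((n choose d) div 2) \<le> card (half_ideals n d :: 'k::field mpoly set set)"
proof -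
  let ?U = "{F. F \<subseteq> {1..n} \<and> card F = d}"
  let ?N = "n choose d"
  let ?C = "{A. A \<subseteq> ?U \<and> card A = ?N div 2}"
  let ?f = "\<lambda>A. Idl\<^bsub>poly_ring n\<^esub> (sqfree_monom ` A) :: 'k mpoly set"
  have finF: "F \<in> Collect finite" if "F \<subseteq> {1..n}" for F :: "nat set"
    using that finite_subset by auto
  have inj: "inj_on sqfree_monom A" if "A \<subseteq> ?U" for A
    by (rule inj_on_subset[OF inj_on_sqfree_monom]) (use that finF in blast)
  have cardU: "card ?U = ?N" using n_subsets[of "{1..n}" d] by simp
  have card_C: "card ?C = ?N choose (?N div 2)"
    using n_subsets[of ?U "?N div 2"] cardU by simp
  have inj_f: "inj_on ?f ?C"
  proof (rule inj_onI)
    fix A B assume A: "A \<in> ?C" and B: "B \<in> ?C" and eq: "?f A = ?f B"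
    from A B have AB: "A \<subseteq> ?U" "B \<subseteq> ?U" by blast+
    have "(sqfree_monom ` A :: 'k mpoly set) = min_gens n (?f A)"
      by (rule min_gens_uniform_family(2)[OF AB(1), symmetric])
    also have "\<dots> = min_gens n (?f B)" by (simp only: eq)
    also have "\<dots> = sqfree_monom ` B" by (rule min_gens_uniform_family(2)[OF AB(2)])
    finally show "A = B"
      using inj_on_image_eq_iff[OF inj[of ?U], of A B] AB by blast
  qed
  have im_f: "?f ` ?C \<subseteq> half_ideals n d"
  proof (rule image_subsetI)
    fix A assume A: "A \<in> ?C"
    then have AU: "A \<subseteq> ?U" by blast
    have "card (sqfree_monom ` A :: 'k mpoly set) = ?N div 2"
      using card_image[OF inj[OF AU]] A by simp
    moreover have "total_degree u = d" if "u \<in> (sqfree_monom ` A :: 'k mpoly set)" for u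
      using that AU finF by (auto simp: total_degree_sqfree_monom)
    ultimately show "?f A \<in> half_ideals n d"
      using assms by (simp add: half_ideals_def min_gens_uniform_family[OF AU])
  qed
  have "card ?C \<le> card (half_ideals n d :: 'k mpoly set set)"
    by (rule card_inj_on_le[OF inj_f im_f finite_half_ideals])
  then show ?thesis by (simp only: card_C)
qed


section \<open>The generators of an \<open>f\<close>-ideal\<close>

text \<open>Equal \<open>f\<close>-vectors have equal lengths, so the two complexes have the same dimension. A face of the
  facet complex lies inside the support of a generator and has at most \<open>d\<close> elements; hence
  a set \<open>T\<close> with more elements is not a face of the Stanley-Reisner complex, which means
  that \<open>x\<^sub>T\<close> belongs to the ideal and is divisible by a generator.\<close>

lemma f_ideal_contains_generator:
  fixes I :: "'k::field mpoly set"
  assumes I: "I \<in> f_ideals n d" and T: "T \<subseteq> {1..n}" "d < card T"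
  shows "\<exists>F\<in>gen_family n I. F \<subseteq> T"
proof -
  have sq: "squarefree_monomial_ideal n I"
    and fv: "f_vector (stanley_reisner_complex n I) = f_vector (facet_complex n I)"
    and deg: "\<And>u. u \<in> min_gens n I \<Longrightarrow> total_degree u = d"
    using I by (auto simp: f_ideals_def f_ideal_def)
  have finF: "finite F" if "F \<subseteq> {1..n}" for F :: "nat set"
    using that finite_subset by auto
  have small: "card F \<le> d" if F: "F \<in> facet_complex n I" for F
  proof -
    obtain u where u: "F \<subseteq> {1..n}" "u \<in> min_gens n I" "sqfree_monom F divides\<^bsub>poly_ring n\<^esub> u"
      using F by (auto simp: facet_complex_def)
    then obtain G where G: "G \<subseteq> {1..n}" "u = sqfree_monom G"
      using min_gens_subset_sqfree_monom[OF sq] by blast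
    have "F \<subseteq> G"
      using sqfree_monom_divides_imp_subset[OF finF finF] u G by blast
    then have "card F \<le> card G" using card_mono finF G(1) by blast
    also have "card G = d" using deg[OF u(2)] G finF by (simp add: total_degree_sqfree_monom)
    finally show ?thesis .
  qed
  have fins: "finite (stanley_reisner_complex n I)" "finite (facet_complex n I)"
    by (auto simp: stanley_reisner_complex_def facet_complex_def)
  have "T \<notin> stanley_reisner_complex n I"
  proof
    assume TS: "T \<in> stanley_reisner_complex n I"
    \<comment> \<open>The empty complex has the empty list as \<open>f\<close>-vector, so it is told apart from any other
      complex by the length as well.\<close>
    have "facet_complex n I \<noteq> {}"
    proof
      assume "facet_complex n I = {}"
      then have "f_vector (stanley_reisner_complex n I) = []" using fv by (simp add: f_vector_def)
      moreover have "stanley_reisner_complex n I \<noteq> {}" using TS by blast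
      ultimately show False by (simp add: f_vector_def)
    qed
    moreover have "Suc (Max (card ` stanley_reisner_complex n I)) = Suc (Max (card ` facet_complex n I))"
    proof -
      have "stanley_reisner_complex n I \<noteq> {}" using TS by blast
      with arg_cong[OF fv, of length] \<open>facet_complex n I \<noteq> {}\<close> show ?thesis
        by (simp add: f_vector_def)
    qed
    moreover have "card T \<le> Max (card ` stanley_reisner_complex n I)"
      using TS fins by simp
    ultimately show False
      using small T(2) fins(2) Max_in[of "card ` facet_complex n I"] by fastforce
  qed
  then have "sqfree_monom T \<in> I" using T(1) by (simp add: stanley_reisner_complex_def)
  moreover have "min_gens n I \<subseteq> monomials n" "Idl\<^bsub>poly_ring n\<^esub> (min_gens n I) = I"
    using min_gens_minimal[OF sq] by (auto simp: minimal_monomial_generating_set_def)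
  ultimately obtain u where u: "u \<in> min_gens n I" "u divides\<^bsub>poly_ring n\<^esub> sqfree_monom T"
    using monomial_in_genideal_iff[of "min_gens n I" n "sqfree_monom T"]
      sqfree_monom_in_monomials[OF T(1)] by auto
  then obtain F where F: "F \<in> gen_family n I" "u = sqfree_monom F"
    using image_gen_family[OF sq] by blast
  then have "F \<subseteq> T"
    using sqfree_monom_divides_imp_subset[OF finF finF, of F T n] T(1) u(2)
    by (auto simp: gen_family_def)
  with F(1) show ?thesis by blast
qed

lemma gen_family_uniform:
  fixes I :: "'k::field mpoly set"
  assumes "I \<in> f_ideals n d"
  shows "gen_family n I \<subseteq> {F. F \<subseteq> {1..n} \<and> card F = d}"
proof
  fix F assume F: "F \<in> gen_family n I"
  then have "F \<subseteq> {1..n}" "total_degree (sqfree_monom F :: 'k mpoly) = d"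
    using assms by (auto simp: gen_family_def f_ideals_def)
  then show "F \<in> {F. F \<subseteq> {1..n} \<and> card F = d}"
    using finite_subset[of F "{1..n}"] by (simp add: total_degree_sqfree_monom)
qed


section \<open>Families that meet disjoint blocks\<close>

text \<open>The counting form of independence over disjoint blocks: splitting \<open>A\<close> into its part inside
  one block and its part outside leaves \<open>2 ^ q - 1\<close> possibilities for the former, and the
  latter is a subset of a smaller universe that meets the remaining blocks.\<close>

lemma card_meeting_blocks_le:
  fixes B :: "'i \<Rightarrow> 'a set"
  assumes "finite J" "finite U"
    and "\<And>j. j \<in> J \<Longrightarrow> B j \<subseteq> U" "\<And>j. j \<in> J \<Longrightarrow> card (B j) = q"
    and "disjoint_family_on B J"
  shows "real (card {A. A \<subseteq> U \<and> (\<forall>j\<in>J. A \<inter> B j \<noteq> {})}) \<le> 2 ^ card U * (1 - 1 / 2 ^ q) ^ card J"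
  using assms
proof (induction J arbitrary: U rule: finite_induct)
  case empty
  have "{A. A \<subseteq> U \<and> (\<forall>j\<in>{}. A \<inter> B j \<noteq> {})} = Pow U" by blast
  then show ?case using empty by (simp add: card_Pow)
next
  case (insert j J)
  let ?M = "{A. A \<subseteq> U \<and> (\<forall>i\<in>insert j J. A \<inter> B i \<noteq> {})}"
  let ?M' = "{A. A \<subseteq> U - B j \<and> (\<forall>i\<in>J. A \<inter> B i \<noteq> {})}"
  have Bj: "B j \<subseteq> U" "card (B j) = q" using insert.prems by auto
  then have finB: "finite (B j)" using insert.prems(1) finite_subset by blast
  have disj: "B i \<inter> B j = {}" if "i \<in> J" for i
    using disjoint_family_onD[OF insert.prems(4), of i j] insert.hyps(2) that by auto
  have le: "q \<le> card U" using Bj card_mono[OF insert.prems(1)] by blast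
  have IH: "real (card ?M') \<le> 2 ^ card (U - B j) * (1 - 1 / 2 ^ q) ^ card J"
  proof (rule insert.IH)
    show "disjoint_family_on B J"
      using insert.prems(4) unfolding disjoint_family_on_def by blast
    show "B i \<subseteq> U - B j" if "i \<in> J" for i
      using insert.prems(2)[of i] disj[OF that] that by blast
  qed (use insert.prems in auto)
  have "card ?M \<le> card ((Pow (B j) - {{}}) \<times> ?M')"
  proof (rule card_inj_on_le)
    show "inj_on (\<lambda>A. (A \<inter> B j, A - B j)) ?M" by (rule inj_onI) blast
    show "(\<lambda>A. (A \<inter> B j, A - B j)) ` ?M \<subseteq> (Pow (B j) - {{}}) \<times> ?M'"
      using disj by blast
    show "finite ((Pow (B j) - {{}}) \<times> ?M')" using finB insert.prems(1) by simp
  qed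
  also have "\<dots> = (2 ^ q - 1) * card ?M'"
    using Bj finB by (simp add: card_cartesian_product card_Diff_singleton card_Pow)
  finally have "real (card ?M) \<le> real ((2 ^ q - 1) * card ?M')" by linarith
  also have "\<dots> = (2 ^ q - 1) * real (card ?M')" by (simp add: of_nat_diff)
  also have "\<dots> \<le> (2 ^ q - 1) * (2 ^ (card U - q) * (1 - 1 / 2 ^ q) ^ card J)"
    using IH Bj finB by (intro mult_left_mono) (simp_all add: card_Diff_subset)
  also have "\<dots> = (2 ^ q * 2 ^ (card U - q)) * (1 - 1 / 2 ^ q) ^ card (insert j J)"
    using insert.hyps by (simp add: field_simps)
  also have "(2::real) ^ q * 2 ^ (card U - q) = 2 ^ card U"
    using le by (simp flip: power_add)
  finally show ?case .
qed

text \<open>The blocks are the families \<open>B j\<close> of \<open>d\<close>-subsets of consecutive intervals \<open>T j\<close> of length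
  \<open>d + 1\<close>. They are disjoint because a nonempty set is contained in at most one of these
  intervals; for \<open>d = 0\<close> they would share the empty set.\<close>

lemma card_f_ideals_le:
  assumes d: "d \<ge> 1"
  shows "real (card (f_ideals n d :: 'k::field mpoly set set))
    \<le> 2 ^ (n choose d) * (1 - 1 / 2 ^ Suc d) ^ (n div Suc d)"
proof -
  let ?U = "{F. F \<subseteq> {1..n} \<and> card F = d}"
  define T where "T j = {j * Suc d + 1..Suc j * Suc d}" for j
  define B where "B j = {F. F \<subseteq> T j \<and> card F = d}" for j
  let ?J = "{..<n div Suc d}"
  let ?M = "{A. A \<subseteq> ?U \<and> (\<forall>j\<in>?J. A \<inter> B j \<noteq> {})}"
  have cardT: "card (T j) = Suc d" for j by (simp add: T_def)
  have TU: "T j \<subseteq> {1..n}" if "j \<in> ?J" for j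
  proof -
    have "Suc j * Suc d \<le> n div Suc d * Suc d" using that by (intro mult_right_mono) auto
    also have "\<dots> \<le> n" by (rule div_times_less_eq_dividend)
    finally show ?thesis by (auto simp: T_def)
  qed
  have Tdisj: "T i \<inter> T j = {}" if "i < j" for i j
  proof -
    have "Suc i * Suc d \<le> j * Suc d" using that by (intro mult_right_mono) auto
    then show ?thesis by (auto simp: T_def)
  qed
  have Bdisj: "B i \<inter> B j = {}" if "i \<noteq> j" for i j
  proof -
    have "T i \<inter> T j = {}" using that Tdisj[of i j] Tdisj[of j i] by (cases i j rule: linorder_cases) auto
    then have "F = {}" if "F \<in> B i" "F \<in> B j" for F using that unfolding B_def by blast
    moreover have "{} \<notin> B i" using d by (simp add: B_def)
    ultimately show ?thesis by blast
  qed
  have "card (f_ideals n d :: 'k mpoly set set) \<le> card ?M"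
  proof (rule card_inj_on_le)
    show "inj_on (gen_family n) (f_ideals n d :: 'k mpoly set set)"
      by (rule inj_on_subset[OF inj_on_gen_family]) (auto simp: f_ideals_def f_ideal_def)
    show "gen_family n ` (f_ideals n d :: 'k mpoly set set) \<subseteq> ?M"
    proof (rule image_subsetI)
      fix I :: "'k mpoly set" assume I: "I \<in> f_ideals n d"
      have "gen_family n I \<inter> B j \<noteq> {}" if "j \<in> ?J" for j
        using f_ideal_contains_generator[OF I TU[OF that]] gen_family_uniform[OF I] cardT[of j]
        by (auto simp: B_def)
      then show "gen_family n I \<in> ?M" using gen_family_uniform[OF I] by blast
    qed
  qed simp
  also have "real (card ?M) \<le> 2 ^ card ?U * (1 - 1 / 2 ^ Suc d) ^ card ?J"
  proof (rule card_meeting_blocks_le)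
    show "B j \<subseteq> ?U" if "j \<in> ?J" for j using TU[OF that] by (auto simp: B_def)
    show "card (B j) = Suc d" for j
      using n_subsets[of "T j" d] cardT[of j] by (simp add: B_def T_def)
    show "disjoint_family_on B ?J" using Bdisj by (auto simp: disjoint_family_on_def)
  qed simp_all
  finally show ?thesis using n_subsets[of "{1..n}" d] by simp
qed


section \<open>The limit\<close>

lemma two_power_le_central_binomial:
  assumes "even N" "N > 0"
  shows "2 ^ N \<le> real N * real (N choose (N div 2))"
proof -
  obtain k where k: "N = 2 * k" using assms(1) by blast
  then show ?thesis
    using central_binomial_lower_bound[of k] assms(2)
    by (simp add: power_mult divide_le_eq mult.commute[of _ "2 * real k"])
qed

lemma ratio_le:
  assumes d: "d \<ge> 1" and n: "d \<le> n" "even (n choose d)"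
  shows "real (card (f_ideals n d :: 'k::field mpoly set set))
           / real (card (half_ideals n d :: 'k mpoly set set))
         \<le> real n ^ d * (1 - 1 / 2 ^ Suc d) ^ (n div Suc d)"
proof -
  let ?N = "n choose d"
  let ?h = "real (card (half_ideals n d :: 'k mpoly set set))"
  let ?r = "(1 - 1 / 2 ^ Suc d) ^ (n div Suc d) :: real"
  have N: "?N > 0" using n by simp
  have r: "?r \<ge> 0" by (intro zero_le_power) (simp add: one_le_power del: power_Suc)
  have "2 ^ ?N \<le> real ?N * real (?N choose (?N div 2))"
    by (rule two_power_le_central_binomial[OF n(2) N])
  also have "\<dots> \<le> real n ^ d * ?h"
  proof (rule mult_mono)
    show "real ?N \<le> real n ^ d"
      using binomial_le_pow[OF n(1)] by (metis of_nat_le_iff of_nat_power)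
    show "real (?N choose (?N div 2)) \<le> ?h"
      using card_half_ideals_ge[OF n(2)] by simp
  qed simp_all
  finally have pow: "2 ^ ?N \<le> real n ^ d * ?h" .
  have h: "?h > 0"
    using card_half_ideals_ge[OF n(2), where 'k='k]
    by (metis binomial_eq_0_iff div_le_dividend gr0I leD le_zero_eq of_nat_0_less_iff)
  have "real (card (f_ideals n d :: 'k mpoly set set)) \<le> 2 ^ ?N * ?r"
    by (rule card_f_ideals_le[OF d])
  also have "\<dots> \<le> (real n ^ d * ?h) * ?r" by (rule mult_right_mono[OF pow r])
  finally show ?thesis using h by (simp add: field_simps)
qed

text \<open>With \<open>r\<close> the \<open>d\<close>-th root of \<open>\<rho>\<close> and \<open>k = n div (d + 1)\<close>, the estimate
  \<open>n \<le> (d + 1) (k + 1)\<close> reduces the claim to the convergence of \<open>(k + 1) * r ^ k\<close> to \<open>0\<close>.\<close>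

lemma power_times_geometric_tendsto_0:
  fixes \<rho> :: real
  assumes "0 < \<rho>" "\<rho> < 1" "d \<ge> 1"
  shows "(\<lambda>n. real n ^ d * \<rho> ^ (n div Suc d)) \<longlonglongrightarrow> 0"
proof -
  define r where "r = root d \<rho>"
  have r: "0 < r" "r < 1" "r ^ d = \<rho>" using assms by (simp_all add: r_def)
  have "(\<lambda>k. real k * r ^ k + r ^ k) \<longlonglongrightarrow> 0 + 0"
    using r by (intro tendsto_add powser_times_n_limit_0 LIMSEQ_realpow_zero) simp_all
  then have "(\<lambda>k. real (Suc d) ^ d * (real k * r ^ k + r ^ k) ^ d) \<longlonglongrightarrow> real (Suc d) ^ d * 0 ^ d"
    by (intro tendsto_intros) simp
  moreover have "real (Suc d) ^ d * 0 ^ d = 0" using assms(3) by simp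
  ultimately have lim: "(\<lambda>k. real (Suc d) ^ d * (real k * r ^ k + r ^ k) ^ d) \<longlonglongrightarrow> 0"
    by (simp only:)
  have "filterlim (\<lambda>n. n div Suc d) sequentially sequentially"
    unfolding filterlim_at_top eventually_sequentially
    by (metis div_le_mono div_mult_self_is_m zero_less_Suc)
  from filterlim_compose[OF lim this]
  have lim': "(\<lambda>n. real (Suc d) ^ d * (real (n div Suc d) * r ^ (n div Suc d) + r ^ (n div Suc d)) ^ d) \<longlonglongrightarrow> 0" .
  show ?thesis
  proof (rule tendsto_sandwich[OF _ _ tendsto_const lim'])
    show "\<forall>\<^sub>F n in sequentially. 0 \<le> real n ^ d * \<rho> ^ (n div Suc d)"
      using assms by simp
    show "\<forall>\<^sub>F n in sequentially. real n ^ d * \<rho> ^ (n div Suc d)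
      \<le> real (Suc d) ^ d * (real (n div Suc d) * r ^ (n div Suc d) + r ^ (n div Suc d)) ^ d"
    proof (intro always_eventually allI)
      fix n
      let ?k = "n div Suc d"
      have "n \<le> Suc d * Suc ?k"
        using dividend_less_div_times[of "Suc d" n] by (simp add: mult.commute del: mult_Suc)
      then have "real n \<le> real (Suc d) * (real ?k + 1)"
        by (metis of_nat_Suc of_nat_le_iff of_nat_mult add.commute)
      then have "real n ^ d \<le> (real (Suc d) * (real ?k + 1)) ^ d" by (intro power_mono) simp_all
      then have "real n ^ d * \<rho> ^ ?k \<le> (real (Suc d) * (real ?k + 1)) ^ d * \<rho> ^ ?k"
        using assms by (intro mult_right_mono) simp_all
      also have "\<dots> = (real (Suc d) * (real ?k + 1)) ^ d * (r ^ ?k) ^ d"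
        unfolding r(3)[symmetric] by (simp add: mult.commute flip: power_mult)
      also have "\<dots> = real (Suc d) ^ d * (real ?k * r ^ ?k + r ^ ?k) ^ d"
        by (simp only: power_mult_distrib[symmetric]) (simp add: algebra_simps)
      finally show "real n ^ d * \<rho> ^ ?k \<le> real (Suc d) ^ d * (real ?k * r ^ ?k + r ^ ?k) ^ d" .
    qed
  qed
qed

theorem theorem3p1:
  fixes d :: nat
  assumes "d \<ge> 2"
  shows "((\<lambda>n. real (card (f_ideals n d :: 'k::field mpoly set set))
               / real (card (half_ideals n d :: 'k mpoly set set))) \<longlongrightarrow> 0)
           (even_binomial_filter d)"
proof -
  have d: "d \<ge> 1" using assms by simp
  have "(\<lambda>n. real n ^ d * (1 - 1 / 2 ^ Suc d) ^ (n div Suc d)) \<longlonglongrightarrow> (0::real)"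
  proof (intro power_times_geometric_tendsto_0 d)
    show "(0::real) < 1 - 1 / 2 ^ Suc d"
      using one_less_power[of "2::real" "Suc d"] by simp
  qed simp
  then have lim: "((\<lambda>n. real n ^ d * (1 - 1 / 2 ^ Suc d) ^ (n div Suc d)) \<longlongrightarrow> (0::real))
      (even_binomial_filter d)"
    by (rule tendsto_mono[rotated]) (simp add: even_binomial_filter_def)
  show ?thesis
  proof (rule tendsto_sandwich[OF _ _ tendsto_const lim])
    show "\<forall>\<^sub>F n in even_binomial_filter d.
        real (card (f_ideals n d :: 'k mpoly set set)) / real (card (half_ideals n d :: 'k mpoly set set))
        \<le> real n ^ d * (1 - 1 / 2 ^ Suc d) ^ (n div Suc d)"
      unfolding even_binomial_filter_def eventually_inf_principal
      using ratio_le[OF d] by (intro always_eventually) auto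
  qed simp
qed

end
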